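(* Let $f_0$ be in $\mathbb{H}_1$ and let $h$ be a real nonnegative measurable function on $\mathcal{X}$, bounded by $1$. Let $\mathcal{C}^\star$ be a symmetric subset of $\mathbb{H}$ (i.e. $\mathcal{C}^\star=-\mathcal{C}^\star$) such that, for $\zeta$-a.e. $x\in\mathcal{X}$, the mapping $\theta\mapsto h(x)\pi_\theta(x)$ belongs to $\mathcal{C}^{\star\perp}$. Then, for every positive integer $n$, $$\inf_{\hat f\in\mathcal{S}_n}\ \sup_{f\in(f_0+\mathcal{C}^\star)\cap\mathbb{H}_1}\mathbb{E}_f\|\hat f-f\|_{\mathbb{H}}^2\ \ge\ \sup\{\|f\|_{\mathbb{H}}^2: f\in\mathcal{C}^\star,\ f_0\pm f\in\mathbb{H}_1\}\,(\pi_{f_0}h)^n .$$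
   Context: $(\mathcal{X},\mathcal{F})$ is a measurable space, $\Theta$ is a Borel subset of $\mathbb{R}^d$ ($d\ge1$), and $(\pi_\theta)_{\theta\in\Theta}$ is a family of probability densities on $\mathcal{X}$ with respect to a common measure $\zeta$ ($\sigma$-finite, with $(\theta,x)\mapsto\pi_\theta(x)$ jointly measurable). $\nu$ is a Radon measure on $\Theta$ and $\mathbb{H}=L^2(\nu)$ (real-valued) with scalar product $(f,g)_{\mathbb{H}}=\int fg\,d\nu$ and norm $\|\cdot\|_{\mathbb{H}}$; $\mathbb{H}$ carries its Borel $\sigma$-field. $\mathbb{H}_+=\{f\in\mathbb{H}:f\ge0\}$ and $\mathbb{H}_1=\{f\in\mathbb{H}_+:\int f\,d\nu=1\}$. For a subset $V$ of $\mathbb{H}$, $V^\perp$ is its orthogonal complement in $\mathbb{H}$. For $f\in\mathbb{H}_1$, $\pi_f(x)=\int_\Theta\pi_\theta(x)f(\theta)\,\nu(d\theta)$ is the mixture density (also denoting the corresponding probability measure $\pi_f\,d\zeta$), and $\pi_f h=\int h\,\pi_f\,d\zeta$. $\mathcal{S}_n$ is the set of measurable functions $\hat f:\mathcal{X}^n\to\mathbb{H}$, and $\mathbb{E}_f$ denotes integration with respect to $\pi_f^{\otimes n}$ (i.e. $\hat f$ is evaluated at $n$ i.i.d. observations from $\pi_f$). The supremum of an empty set of nonnegative numbers is $0$. *)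

theory Defs
  imports "HOL-Analysis.Analysis"
begin

section \<open>The Hilbert space of classes of square-integrable functions\<close>

definition L2_fun :: "'a measure \<Rightarrow> ('a \<Rightarrow> real) set" where
  "L2_fun \<nu> = {f \<in> borel_measurable \<nu>. integrable \<nu> (\<lambda>t. (f t)\<^sup>2)}"

definition L2_rel :: "'a measure \<Rightarrow> (('a \<Rightarrow> real) \<times> ('a \<Rightarrow> real)) set" where
  "L2_rel \<nu> = {(f, g). f \<in> L2_fun \<nu> \<and> g \<in> L2_fun \<nu> \<and> (AE t in \<nu>. f t = g t)}"

definition L2 :: "'a measure \<Rightarrow> ('a \<Rightarrow> real) set set" where
  "L2 \<nu> = L2_fun \<nu> // L2_rel \<nu>"

text \<open>If \<open>f\<close> is not square-integrable, then \<open>L2_class \<nu> f\<close> is empty, hence not an element of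
  \<open>L2 \<nu>\<close>. So \<open>L2_class \<nu> f \<in> V\<close> with \<open>V \<subseteq> L2 \<nu>\<close> entails that \<open>f\<close> is square-integrable.\<close>

definition L2_class :: "'a measure \<Rightarrow> ('a \<Rightarrow> real) \<Rightarrow> ('a \<Rightarrow> real) set" where
  "L2_class \<nu> f = L2_rel \<nu> `` {f}"

definition L2_rep :: "('a \<Rightarrow> real) set \<Rightarrow> 'a \<Rightarrow> real" where
  "L2_rep F = (SOME f. f \<in> F)"

definition L2_add :: "'a measure \<Rightarrow> ('a \<Rightarrow> real) set \<Rightarrow> ('a \<Rightarrow> real) set \<Rightarrow> ('a \<Rightarrow> real) set" where
  "L2_add \<nu> F G = L2_class \<nu> (\<lambda>t. L2_rep F t + L2_rep G t)"

definition L2_minus :: "'a measure \<Rightarrow> ('a \<Rightarrow> real) set \<Rightarrow> ('a \<Rightarrow> real) set \<Rightarrow> ('a \<Rightarrow> real) set" where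
  "L2_minus \<nu> F G = L2_class \<nu> (\<lambda>t. L2_rep F t - L2_rep G t)"

definition L2_uminus :: "'a measure \<Rightarrow> ('a \<Rightarrow> real) set \<Rightarrow> ('a \<Rightarrow> real) set" where
  "L2_uminus \<nu> F = L2_class \<nu> (\<lambda>t. - L2_rep F t)"

definition L2_inner :: "'a measure \<Rightarrow> ('a \<Rightarrow> real) set \<Rightarrow> ('a \<Rightarrow> real) set \<Rightarrow> real" where
  "L2_inner \<nu> F G = (LINT t|\<nu>. L2_rep F t * L2_rep G t)"

definition L2_norm :: "'a measure \<Rightarrow> ('a \<Rightarrow> real) set \<Rightarrow> real" where
  "L2_norm \<nu> F = sqrt (L2_inner \<nu> F F)"

definition L2_dist :: "'a measure \<Rightarrow> ('a \<Rightarrow> real) set \<Rightarrow> ('a \<Rightarrow> real) set \<Rightarrow> real" where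
  "L2_dist \<nu> F G = L2_norm \<nu> (L2_minus \<nu> F G)"

definition L2_borel :: "'a measure \<Rightarrow> ('a \<Rightarrow> real) set measure" where
  "L2_borel \<nu> = sigma (L2 \<nu>) {U. openin (Metric_space.mtopology (L2 \<nu>) (L2_dist \<nu>)) U}"

definition L2_orth :: "'a measure \<Rightarrow> ('a \<Rightarrow> real) set set \<Rightarrow> ('a \<Rightarrow> real) set set" where
  "L2_orth \<nu> V = {F \<in> L2 \<nu>. \<forall>G\<in>V. L2_inner \<nu> F G = 0}"

definition L2_nonneg :: "'a measure \<Rightarrow> ('a \<Rightarrow> real) set set" where
  "L2_nonneg \<nu> = {F \<in> L2 \<nu>. AE t in \<nu>. 0 \<le> L2_rep F t}"

text \<open>The Bochner integral of a non-integrable function is \<open>0\<close>, so the value \<open>1\<close> below entails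
  integrability.\<close>

definition L2_prob :: "'a measure \<Rightarrow> ('a \<Rightarrow> real) set set" where
  "L2_prob \<nu> = {F \<in> L2_nonneg \<nu>. (LINT t|\<nu>. L2_rep F t) = 1}"


subsection \<open>Well-definedness\<close>

lemma L2_equiv: "equiv (L2_fun \<nu>) (L2_rel \<nu>)"
proof (rule equivI)
  show "L2_rel \<nu> \<subseteq> L2_fun \<nu> \<times> L2_fun \<nu>" by (auto simp: L2_rel_def)
  show "refl_on (L2_fun \<nu>) (L2_rel \<nu>)" by (auto simp: refl_on_def L2_rel_def)
  show "sym (L2_rel \<nu>)" by (auto simp: sym_def L2_rel_def eq_commute)
  show "trans (L2_rel \<nu>)"
  proof (rule transI)
    fix f g k assume "(f, g) \<in> L2_rel \<nu>" "(g, k) \<in> L2_rel \<nu>"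
    then have fk: "f \<in> L2_fun \<nu>" "k \<in> L2_fun \<nu>" and e: "AE t in \<nu>. f t = g t" "AE t in \<nu>. g t = k t"
      by (auto simp: L2_rel_def)
    from e have "AE t in \<nu>. f t = k t" by eventually_elim simp
    with fk show "(f, k) \<in> L2_rel \<nu>" by (simp add: L2_rel_def)
  qed
qed

lemma L2_class_in: "f \<in> L2_fun \<nu> \<Longrightarrow> L2_class \<nu> f \<in> L2 \<nu>"
  unfolding L2_class_def L2_def by (rule quotientI)

lemma L2_rep_class:
  assumes "f \<in> L2_fun \<nu>"
  shows "L2_rep (L2_class \<nu> f) \<in> L2_fun \<nu>" "AE t in \<nu>. L2_rep (L2_class \<nu> f) t = f t"
proof -
  have "f \<in> L2_class \<nu> f" using assms by (auto simp: L2_class_def L2_rel_def)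
  then have "L2_rep (L2_class \<nu> f) \<in> L2_class \<nu> f" unfolding L2_rep_def by (rule someI[where P = "\<lambda>g. g \<in> L2_class \<nu> f"])
  then have "L2_rep (L2_class \<nu> f) \<in> L2_fun \<nu> \<and> (AE t in \<nu>. f t = L2_rep (L2_class \<nu> f) t)"
    by (auto simp: L2_class_def L2_rel_def)
  then show "L2_rep (L2_class \<nu> f) \<in> L2_fun \<nu>" "AE t in \<nu>. L2_rep (L2_class \<nu> f) t = f t"
    by (auto simp: eq_commute)
qed

lemma L2_class_eq_iff:
  "f \<in> L2_fun \<nu> \<Longrightarrow> g \<in> L2_fun \<nu> \<Longrightarrow> L2_class \<nu> f = L2_class \<nu> g \<longleftrightarrow> (AE t in \<nu>. f t = g t)"
  unfolding L2_class_def using eq_equiv_class_iff[OF L2_equiv] by (auto simp: L2_rel_def)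

lemma L2_rep:
  assumes "F \<in> L2 \<nu>"
  shows "L2_rep F \<in> L2_fun \<nu>" "L2_class \<nu> (L2_rep F) = F"
proof -
  obtain f where f: "f \<in> L2_fun \<nu>" "F = L2_class \<nu> f"
    using assms unfolding L2_def L2_class_def by (auto elim: quotientE)
  show "L2_rep F \<in> L2_fun \<nu>" using L2_rep_class f by auto
  with f show "L2_class \<nu> (L2_rep F) = F"
    using L2_class_eq_iff L2_rep_class by metis
qed

lemma L2_fun_mult:
  assumes "f \<in> L2_fun \<nu>" "g \<in> L2_fun \<nu>"
  shows "integrable \<nu> (\<lambda>t. f t * g t)"
proof (rule Bochner_Integration.integrable_bound)
  show "integrable \<nu> (\<lambda>t. (f t)\<^sup>2 + (g t)\<^sup>2)" using assms by (auto simp: L2_fun_def)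
  show "(\<lambda>t. f t * g t) \<in> borel_measurable \<nu>" using assms by (auto simp: L2_fun_def)
  have "\<bar>a * b\<bar> \<le> a\<^sup>2 + b\<^sup>2" for a b :: real
  proof -
    have "2 * (\<bar>a\<bar> * \<bar>b\<bar>) \<le> a\<^sup>2 + b\<^sup>2" using sum_squares_bound[of "\<bar>a\<bar>" "\<bar>b\<bar>"] by simp
    moreover have "0 \<le> \<bar>a\<bar> * \<bar>b\<bar>" by simp
    ultimately show ?thesis unfolding abs_mult by linarith
  qed
  then show "AE t in \<nu>. norm (f t * g t) \<le> norm ((f t)\<^sup>2 + (g t)\<^sup>2)" by auto
qed

lemma L2_fun_closed:
  assumes "f \<in> L2_fun \<nu>" "g \<in> L2_fun \<nu>"
  shows "(\<lambda>t. f t + g t) \<in> L2_fun \<nu>" "(\<lambda>t. f t - g t) \<in> L2_fun \<nu>" "(\<lambda>t. c * f t) \<in> L2_fun \<nu>"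
    "(\<lambda>t. - f t) \<in> L2_fun \<nu>"
proof -
  have [measurable]: "f \<in> borel_measurable \<nu>" "g \<in> borel_measurable \<nu>"
    and i: "integrable \<nu> (\<lambda>t. (f t)\<^sup>2)" "integrable \<nu> (\<lambda>t. (g t)\<^sup>2)" "integrable \<nu> (\<lambda>t. f t * g t)"
    using assms L2_fun_mult[OF assms] by (auto simp: L2_fun_def)
  show "(\<lambda>t. f t + g t) \<in> L2_fun \<nu>" "(\<lambda>t. f t - g t) \<in> L2_fun \<nu>" "(\<lambda>t. c * f t) \<in> L2_fun \<nu>"
    "(\<lambda>t. - f t) \<in> L2_fun \<nu>"
    using i by (simp_all add: L2_fun_def power2_sum power2_diff power_mult_distrib mult.assoc)
qed

lemma L2_inner_class:
  assumes "f \<in> L2_fun \<nu>" "g \<in> L2_fun \<nu>"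
  shows "L2_inner \<nu> (L2_class \<nu> f) (L2_class \<nu> g) = (LINT t|\<nu>. f t * g t)"
  unfolding L2_inner_def
proof (rule integral_cong_AE)
  show "AE t in \<nu>. L2_rep (L2_class \<nu> f) t * L2_rep (L2_class \<nu> g) t = f t * g t"
    using L2_rep_class(2)[OF assms(1)] L2_rep_class(2)[OF assms(2)] by eventually_elim simp
qed (use assms L2_rep_class(1)[OF assms(1)] L2_rep_class(1)[OF assms(2)] in
    \<open>auto simp: L2_fun_def\<close>)

lemma L2_norm_class:
  "f \<in> L2_fun \<nu> \<Longrightarrow> L2_norm \<nu> (L2_class \<nu> f) = sqrt (LINT t|\<nu>. (f t)\<^sup>2)"
  by (simp add: L2_norm_def L2_inner_class power2_eq_square)

lemma L2_dist_eq:
  "F \<in> L2 \<nu> \<Longrightarrow> G \<in> L2 \<nu> \<Longrightarrow> L2_dist \<nu> F G = sqrt (LINT t|\<nu>. (L2_rep F t - L2_rep G t)\<^sup>2)"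
  by (simp add: L2_dist_def L2_minus_def L2_norm_class L2_fun_closed L2_rep)

lemma L2_fun_Cauchy_Schwarz:
  assumes "f \<in> L2_fun \<nu>" "g \<in> L2_fun \<nu>"
  shows "(LINT t|\<nu>. f t * g t) \<le> sqrt (LINT t|\<nu>. (f t)\<^sup>2) * sqrt (LINT t|\<nu>. (g t)\<^sup>2)"
proof -
  define A B C where "A = (LINT t|\<nu>. (f t)\<^sup>2)" and "B = (LINT t|\<nu>. f t * g t)"
    and "C = (LINT t|\<nu>. (g t)\<^sup>2)"
  have i: "integrable \<nu> (\<lambda>t. (f t)\<^sup>2)" "integrable \<nu> (\<lambda>t. (g t)\<^sup>2)" "integrable \<nu> (\<lambda>t. f t * g t)"
    using assms L2_fun_mult by (auto simp: L2_fun_def)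
  have A0: "0 \<le> A" and C0: "0 \<le> C" by (simp_all add: A_def C_def)
  have q: "0 \<le> a\<^sup>2 * A - 2 * a * b * B + b\<^sup>2 * C" for a b :: real
  proof -
    have "0 \<le> (LINT t|\<nu>. (a * f t - b * g t)\<^sup>2)" by simp
    also have "\<dots> = (LINT t|\<nu>. a\<^sup>2 * (f t)\<^sup>2 - 2 * a * b * (f t * g t) + b\<^sup>2 * (g t)\<^sup>2)"
      by (simp add: power2_diff power_mult_distrib algebra_simps)
    also have "\<dots> = a\<^sup>2 * A - 2 * a * b * B + b\<^sup>2 * C" using i by (simp add: A_def B_def C_def)
    finally show ?thesis .
  qed
  have "B\<^sup>2 \<le> A * C"
  proof (cases "A = 0 \<and> C = 0")
    case True
    then show ?thesis using q[of 1 1] q[of 1 "-1"] by auto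
  next
    case False
    have "0 \<le> C * (A * C - B\<^sup>2)" using q[of C B] by (simp add: algebra_simps power2_eq_square)
    moreover have "0 \<le> A * (A * C - B\<^sup>2)" using q[of B A] by (simp add: algebra_simps power2_eq_square)
    ultimately show ?thesis using False A0 C0 by (auto simp: zero_le_mult_iff)
  qed
  then have "\<bar>B\<bar> \<le> sqrt (A * C)" using real_le_rsqrt by fastforce
  then show ?thesis unfolding A_def B_def C_def by (simp add: real_sqrt_mult)
qed

lemma L2_Metric_space: "Metric_space (L2 \<nu>) (L2_dist \<nu>)"
proof
  show "0 \<le> L2_dist \<nu> F G" for F G
    by (simp add: L2_dist_def L2_norm_def L2_inner_def)
  show "L2_dist \<nu> F G = L2_dist \<nu> G F" for F G
  proof -
    let ?d = "\<lambda>t. L2_rep F t - L2_rep G t" and ?e = "\<lambda>t. L2_rep G t - L2_rep F t"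
    have iff: "?d \<in> L2_fun \<nu> \<longleftrightarrow> ?e \<in> L2_fun \<nu>"
      using L2_fun_closed(4)[of ?d \<nu>] L2_fun_closed(4)[of ?e \<nu>] by auto
    show ?thesis
    proof (cases "?d \<in> L2_fun \<nu>")
      case True
      with iff show ?thesis
        by (simp add: L2_dist_def L2_minus_def L2_norm_class power2_commute)
    next
      case False
      with iff have "L2_class \<nu> ?d = {}" "L2_class \<nu> ?e = {}" by (auto simp: L2_class_def L2_rel_def)
      then show ?thesis by (simp add: L2_dist_def L2_minus_def)
    qed
  qed
  show "L2_dist \<nu> F G = 0 \<longleftrightarrow> F = G" if "F \<in> L2 \<nu>" "G \<in> L2 \<nu>" for F G
  proof -
    have "integrable \<nu> (\<lambda>t. (L2_rep F t - L2_rep G t)\<^sup>2)"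
      using L2_fun_closed(2)[OF L2_rep(1)[OF that(1)] L2_rep(1)[OF that(2)]] by (simp add: L2_fun_def)
    then have "L2_dist \<nu> F G = 0 \<longleftrightarrow> (AE t in \<nu>. L2_rep F t = L2_rep G t)"
      using that by (simp add: L2_dist_eq integral_nonneg_eq_0_iff_AE)
    also have "\<dots> \<longleftrightarrow> F = G" using L2_class_eq_iff L2_rep that by metis
    finally show ?thesis .
  qed
  show "L2_dist \<nu> F K \<le> L2_dist \<nu> F G + L2_dist \<nu> G K"
    if "F \<in> L2 \<nu>" "G \<in> L2 \<nu>" "K \<in> L2 \<nu>" for F G K
  proof -
    define f g where "f = (\<lambda>t. L2_rep F t - L2_rep G t)" and "g = (\<lambda>t. L2_rep G t - L2_rep K t)"
    have fg: "f \<in> L2_fun \<nu>" "g \<in> L2_fun \<nu>"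
      using that by (auto simp: f_def g_def L2_fun_closed L2_rep)
    have i: "integrable \<nu> (\<lambda>t. (f t)\<^sup>2)" "integrable \<nu> (\<lambda>t. (g t)\<^sup>2)" "integrable \<nu> (\<lambda>t. f t * g t)"
      using fg L2_fun_mult by (auto simp: L2_fun_def)
    have "(LINT t|\<nu>. (L2_rep F t - L2_rep K t)\<^sup>2)
        = (LINT t|\<nu>. (f t)\<^sup>2 + (g t)\<^sup>2 + 2 * (f t * g t))"
      by (rule Bochner_Integration.integral_cong) (auto simp: f_def g_def power2_eq_square algebra_simps)
    also have "\<dots> = (LINT t|\<nu>. (f t)\<^sup>2) + (LINT t|\<nu>. (g t)\<^sup>2) + 2 * (LINT t|\<nu>. f t * g t)"
      using i by simp
    also have "\<dots> \<le> (sqrt (LINT t|\<nu>. (f t)\<^sup>2) + sqrt (LINT t|\<nu>. (g t)\<^sup>2))\<^sup>2"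
      using L2_fun_Cauchy_Schwarz[OF fg] by (simp add: power2_sum)
    finally have "sqrt (LINT t|\<nu>. (L2_rep F t - L2_rep K t)\<^sup>2)
        \<le> sqrt (LINT t|\<nu>. (f t)\<^sup>2) + sqrt (LINT t|\<nu>. (g t)\<^sup>2)"
      by (intro real_le_lsqrt) auto
    then show ?thesis using that by (simp add: L2_dist_eq f_def g_def)
  qed
qed


section \<open>Radon measures and mixtures\<close>

definition radon_on :: "'a::topological_space set \<Rightarrow> 'a measure \<Rightarrow> bool" where
  "radon_on \<Theta> \<nu> \<longleftrightarrow>
     sets \<nu> = sets (restrict_space borel \<Theta>) \<and>
     (\<forall>t\<in>\<Theta>. \<exists>U. open U \<and> t \<in> U \<and> emeasure \<nu> (U \<inter> \<Theta>) < \<infinity>) \<and>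
     (\<forall>A\<in>sets \<nu>. emeasure \<nu> A = (SUP K\<in>{K. compact K \<and> K \<subseteq> A}. emeasure \<nu> K))"

text \<open>The representative of \<open>F\<close> may be negative on a null set; \<open>ennreal\<close> truncates there.\<close>

definition mixture_density ::
  "'a measure \<Rightarrow> ('a \<Rightarrow> 'x \<Rightarrow> real) \<Rightarrow> ('a \<Rightarrow> real) set \<Rightarrow> 'x \<Rightarrow> ennreal" where
  "mixture_density \<nu> \<pi> F x = (\<integral>\<^sup>+t. ennreal (\<pi> t x * L2_rep F t) \<partial>\<nu>)"

definition mixture ::
  "'x measure \<Rightarrow> 'a measure \<Rightarrow> ('a \<Rightarrow> 'x \<Rightarrow> real) \<Rightarrow> ('a \<Rightarrow> real) set \<Rightarrow> 'x measure" where
  "mixture \<zeta> \<nu> \<pi> F = density \<zeta> (mixture_density \<nu> \<pi> F)"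

definition estimators :: "'x measure \<Rightarrow> 'a measure \<Rightarrow> nat \<Rightarrow> ((nat \<Rightarrow> 'x) \<Rightarrow> ('a \<Rightarrow> real) set) set" where
  "estimators \<zeta> \<nu> n = measurable (PiM {..<n} (\<lambda>_. \<zeta>)) (L2_borel \<nu>)"

definition risk ::
  "'x measure \<Rightarrow> 'a measure \<Rightarrow> ('a \<Rightarrow> 'x \<Rightarrow> real) \<Rightarrow> nat \<Rightarrow> ((nat \<Rightarrow> 'x) \<Rightarrow> ('a \<Rightarrow> real) set)
    \<Rightarrow> ('a \<Rightarrow> real) set \<Rightarrow> ennreal" where
  "risk \<zeta> \<nu> \<pi> n fhat F =
     (\<integral>\<^sup>+x. ennreal ((L2_norm \<nu> (L2_minus \<nu> (fhat x) F))\<^sup>2) \<partial>PiM {..<n} (\<lambda>_. mixture \<zeta> \<nu> \<pi> F))"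

end

theory Submission
  imports Defs "HOL-Probability.Probability_Measure"
begin

text \<open>
  Two-point argument. For \<open>f \<in> C\<close> with \<open>f\<^sub>0 \<plusminus> f\<close> both densities, orthogonality gives
  \<open>h \<pi>\<^bsub>f\<^sub>0 + f\<^esub> = h \<pi>\<^bsub>f\<^sub>0\<^esub> = h \<pi>\<^bsub>f\<^sub>0 - f\<^esub>\<close> almost everywhere. Since \<open>h \<le> 1\<close>, both risks are bounded
  below by integrals against the same measure, the \<open>n\<close>-th power of \<open>h \<pi>\<^bsub>f\<^sub>0\<^esub> d\<zeta>\<close>, and by the
  parallelogram identity the two integrands add up to at least twice the squared norm of \<open>f\<close>.
\<close>

section \<open>Measurability of the distance and geometry of L2 classes\<close>

text \<open>Strict sublevel sets of the distance are open balls, which belong to the generating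
  family of \<open>L2_borel\<close>. This makes the loss of an estimator a measurable function of
  the observations.\<close>

lemma L2_dist_measurable:
  assumes "F \<in> L2 \<nu>"
  shows "(\<lambda>G. L2_dist \<nu> G F) \<in> borel_measurable (L2_borel \<nu>)"
proof (rule borel_measurableI_less)
  interpret Metric_space "L2 \<nu>" "L2_dist \<nu>" by (rule L2_Metric_space)
  \<comment> \<open>\<open>sigma\<close> gives the generated field only if all generators are
    subsets of the carrier; otherwise its field is trivial.\<close>
  have sub: "{U. openin mtopology U} \<subseteq> Pow (L2 \<nu>)"
    using openin_subset[of mtopology] by auto
  fix r
  have "{G \<in> space (L2_borel \<nu>). L2_dist \<nu> G F < r} = mball F r"
    using assms sub by (auto simp: L2_borel_def space_measure_of_conv commute)
  moreover have "mball F r \<in> sets (L2_borel \<nu>)"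
    unfolding L2_borel_def using sub by (simp add: sets_measure_of openin_mball)
  ultimately show "{G \<in> space (L2_borel \<nu>). L2_dist \<nu> G F < r} \<in> sets (L2_borel \<nu>)"
    by simp
qed

lemma L2_rep_add:
  assumes "F \<in> L2 \<nu>" "G \<in> L2 \<nu>"
  shows "AE t in \<nu>. L2_rep (L2_add \<nu> F G) t = L2_rep F t + L2_rep G t"
  unfolding L2_add_def using assms by (intro L2_rep_class L2_fun_closed L2_rep)

lemma L2_rep_minus:
  assumes "F \<in> L2 \<nu>" "G \<in> L2 \<nu>"
  shows "AE t in \<nu>. L2_rep (L2_minus \<nu> F G) t = L2_rep F t - L2_rep G t"
  unfolding L2_minus_def using assms by (intro L2_rep_class L2_fun_closed L2_rep)

text \<open>Used to recognise \<open>f\<^sub>0 - f\<close> as a member of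
  \<open>f\<^sub>0 + C\<close> when \<open>C\<close> is symmetric.\<close>

lemma L2_minus_eq_add_uminus:
  assumes "F \<in> L2 \<nu>" "G \<in> L2 \<nu>"
  shows "L2_minus \<nu> F G = L2_add \<nu> F (L2_uminus \<nu> G)"
proof -
  have mG: "(\<lambda>t. - L2_rep G t) \<in> L2_fun \<nu>"
    using L2_fun_closed(4)[OF L2_rep(1) L2_rep(1)] assms(2) by blast
  show ?thesis
    unfolding L2_minus_def L2_add_def
  proof (subst L2_class_eq_iff)
    show "AE t in \<nu>. L2_rep F t - L2_rep G t = L2_rep F t + L2_rep (L2_uminus \<nu> G) t"
      using L2_rep_class(2)[OF mG] unfolding L2_uminus_def by eventually_elim simp
    show "(\<lambda>t. L2_rep F t + L2_rep (L2_uminus \<nu> G) t) \<in> L2_fun \<nu>"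
      unfolding L2_uminus_def using assms mG by (intro L2_fun_closed L2_rep L2_class_in)
  qed (use assms in \<open>auto intro: L2_fun_closed L2_rep\<close>)
qed

text \<open>Integrate the identity
  \<open>(a - (b + c))^2 + (a - (b - c))^2 = 2 (a - b)^2 + 2 c^2\<close> and drop the nonnegative
  term in \<open>a - b\<close>. Hence no single estimate \<open>H\<close> is close to both
  perturbations of \<open>F\<close>.\<close>

lemma L2_two_point:
  assumes H: "H \<in> L2 \<nu>" and F: "F \<in> L2 \<nu>" and G: "G \<in> L2 \<nu>"
    and P: "L2_add \<nu> F G \<in> L2 \<nu>" and M: "L2_minus \<nu> F G \<in> L2 \<nu>"
  shows "2 * (L2_norm \<nu> G)\<^sup>2
    \<le> (L2_norm \<nu> (L2_minus \<nu> H (L2_add \<nu> F G)))\<^sup>2 + (L2_norm \<nu> (L2_minus \<nu> H (L2_minus \<nu> F G)))\<^sup>2"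
proof -
  define p m where "p = (\<lambda>t. L2_rep H t - L2_rep (L2_add \<nu> F G) t)"
    and "m = (\<lambda>t. L2_rep H t - L2_rep (L2_minus \<nu> F G) t)"
  have L: "p \<in> L2_fun \<nu>" "m \<in> L2_fun \<nu>" "L2_rep G \<in> L2_fun \<nu>"
    unfolding p_def m_def using assms by (auto intro!: L2_fun_closed L2_rep)
  then have i: "integrable \<nu> (\<lambda>t. (p t)\<^sup>2)" "integrable \<nu> (\<lambda>t. (m t)\<^sup>2)"
      "integrable \<nu> (\<lambda>t. (L2_rep G t)\<^sup>2)"
    by (auto simp: L2_fun_def)
  have par: "2 * c\<^sup>2 \<le> (a - (b + c))\<^sup>2 + (a - (b - c))\<^sup>2" for a b c :: real
  proof -
    have "(a - (b + c))\<^sup>2 + (a - (b - c))\<^sup>2 = 2 * (a - b)\<^sup>2 + 2 * c\<^sup>2"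
      by (simp add: power2_eq_square algebra_simps)
    then show ?thesis by simp
  qed
  have "2 * (L2_norm \<nu> G)\<^sup>2 = (LINT t|\<nu>. 2 * (L2_rep G t)\<^sup>2)"
    by (simp add: L2_norm_def L2_inner_def flip: power2_eq_square)
  \<comment> \<open>The representatives of the sum and difference classes are arbitrary choices, so
    the pointwise bound is available only almost everywhere.\<close>
  also have "\<dots> \<le> (LINT t|\<nu>. (p t)\<^sup>2 + (m t)\<^sup>2)"
  proof (rule integral_mono_AE)
    show "AE t in \<nu>. 2 * (L2_rep G t)\<^sup>2 \<le> (p t)\<^sup>2 + (m t)\<^sup>2"
      using L2_rep_add[OF F G] L2_rep_minus[OF F G]
      by eventually_elim (simp add: p_def m_def par)
  qed (use i in auto)
  also have "\<dots> = (LINT t|\<nu>. (p t)\<^sup>2) + (LINT t|\<nu>. (m t)\<^sup>2)"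
    using i by simp
  also have "\<dots> = (L2_dist \<nu> H (L2_add \<nu> F G))\<^sup>2 + (L2_dist \<nu> H (L2_minus \<nu> F G))\<^sup>2"
    using assms by (simp add: L2_dist_eq p_def m_def)
  finally show ?thesis by (simp add: L2_dist_def)
qed

section \<open>Product measures with densities, and mixtures as probability measures\<close>

text \<open>Both measures agree on rectangles, because the integral of a product of one-coordinate
  functions factorises; uniqueness of the product measure does the rest. \<open>fin\<close> is an
  assumption since a density with infinite values can destroy sigma-finiteness.\<close>

lemma (in product_sigma_finite) PiM_density_finite:
  assumes I: "finite I"
    and g: "\<And>i. i \<in> I \<Longrightarrow> g i \<in> borel_measurable (M i)"
    and fin: "\<And>i. sigma_finite_measure (density (M i) (g i))"
  shows "density (PiM I M) (\<lambda>x. \<Prod>i\<in>I. g i (x i)) = PiM I (\<lambda>i. density (M i) (g i))"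
proof -
  interpret D: product_sigma_finite "\<lambda>i. density (M i) (g i)"
    unfolding product_sigma_finite_def using fin by blast
  have meas: "(\<lambda>x. \<Prod>i\<in>I. g i (x i)) \<in> borel_measurable (PiM I M)"
    using g by (auto intro!: borel_measurable_prod measurable_compose[OF measurable_component_singleton])
  show ?thesis
  proof (rule D.PiM_eqI[OF I])
    show "sets (density (PiM I M) (\<lambda>x. \<Prod>i\<in>I. g i (x i))) = sets (PiM I (\<lambda>i. density (M i) (g i)))"
      by (simp cong: sets_PiM_cong)
    fix A assume A: "\<And>i. i \<in> I \<Longrightarrow> A i \<in> sets (density (M i) (g i))"
    then have A': "\<And>i. i \<in> I \<Longrightarrow> A i \<in> sets (M i)" by simp
    have "emeasure (density (PiM I M) (\<lambda>x. \<Prod>i\<in>I. g i (x i))) (Pi\<^sub>E I A)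
        = (\<integral>\<^sup>+x. (\<Prod>i\<in>I. g i (x i)) * indicator (Pi\<^sub>E I A) x \<partial>PiM I M)"
      using meas A' I by (intro emeasure_density sets_PiM_I_finite) auto
    also have "\<dots> = (\<integral>\<^sup>+x. (\<Prod>i\<in>I. g i (x i) * indicator (A i) (x i)) \<partial>PiM I M)"
    proof (rule nn_integral_cong)
      fix x assume "x \<in> space (PiM I M)"
      then have "indicator (Pi\<^sub>E I A) x = (\<Prod>i\<in>I. indicator (A i) (x i) :: ennreal)"
        using I by (auto simp: indicator_def space_PiM PiE_iff prod_zero_iff)
      then show "(\<Prod>i\<in>I. g i (x i)) * indicator (Pi\<^sub>E I A) x
          = (\<Prod>i\<in>I. g i (x i) * indicator (A i) (x i))"
        by (simp add: prod.distrib)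
    qed
    also have "\<dots> = (\<Prod>i\<in>I. \<integral>\<^sup>+x. g i x * indicator (A i) x \<partial>M i)"
      using g A' by (intro product_nn_integral_prod I) auto
    also have "\<dots> = (\<Prod>i\<in>I. emeasure (density (M i) (g i)) (A i))"
      using g A' by (intro prod.cong refl) (simp add: emeasure_density)
    finally show "emeasure (density (PiM I M) (\<lambda>x. \<Prod>i\<in>I. g i (x i))) (Pi\<^sub>E I A)
        = (\<Prod>i\<in>I. emeasure (density (M i) (g i)) (A i))" .
  qed
qed

text \<open>Tonelli is applied to the probability measure \<open>F d\<nu>\<close>, as \<open>\<nu>\<close> may fail to be \<open>\<sigma>\<close>-finite.\<close>

lemma mixture_density_prob:
  assumes \<zeta>: "sigma_finite_measure \<zeta>"
    and meas: "(\<lambda>(t, x). \<pi> t x) \<in> borel_measurable (\<nu> \<Otimes>\<^sub>M \<zeta>)"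
    and nonneg: "\<And>t x. t \<in> space \<nu> \<Longrightarrow> x \<in> space \<zeta> \<Longrightarrow> 0 \<le> \<pi> t x"
    and one: "\<And>t. t \<in> space \<nu> \<Longrightarrow> (\<integral>\<^sup>+x. ennreal (\<pi> t x) \<partial>\<zeta>) = 1"
    and F: "F \<in> L2_prob \<nu>"
  shows "mixture_density \<nu> \<pi> F \<in> borel_measurable \<zeta>"
    and "prob_space (mixture \<zeta> \<nu> \<pi> F)"
proof -
  note [measurable] = meas
  have [measurable]: "L2_rep F \<in> borel_measurable \<nu>"
    using F L2_rep(1)[of F \<nu>] by (auto simp: L2_prob_def L2_nonneg_def L2_fun_def)
  have int1: "(LINT t|\<nu>. L2_rep F t) = 1" and AEF: "AE t in \<nu>. 0 \<le> L2_rep F t"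
    using F by (auto simp: L2_prob_def L2_nonneg_def)
  \<comment> \<open>A non-integrable function would have Bochner integral \<open>0\<close>, not
    \<open>1\<close>.\<close>
  then have "integrable \<nu> (L2_rep F)"
    using not_integrable_integral_eq by fastforce
  then have mass: "(\<integral>\<^sup>+t. ennreal (L2_rep F t) \<partial>\<nu>) = 1"
    using nn_integral_eq_integral[of \<nu> "L2_rep F"] int1 AEF by simp
  define D where "D = density \<nu> (\<lambda>t. ennreal (L2_rep F t))"
  interpret D: prob_space D
    by standard (simp add: D_def emeasure_density mass cong: nn_integral_cong)
  have [measurable_cong]: "sets D = sets \<nu>" by (simp add: D_def)
  interpret \<zeta>: sigma_finite_measure \<zeta> by (rule \<zeta>)
  interpret DZ: pair_sigma_finite D \<zeta> ..
  have [measurable]: "(\<lambda>t. \<pi> t x) \<in> borel_measurable \<nu>" if "x \<in> space \<zeta>" for x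
    using measurable_compose[OF measurable_Pair2'[OF that] meas] by simp
  \<comment> \<open>Where the representative is negative, truncation makes both integrands vanish,
    so they agree at every point of the space.\<close>
  have eq: "mixture_density \<nu> \<pi> F x = (\<integral>\<^sup>+t. ennreal (\<pi> t x) \<partial>D)" if x: "x \<in> space \<zeta>" for x
    unfolding mixture_density_def D_def using x
    by (subst nn_integral_density)
      (auto intro!: nn_integral_cong simp: ennreal_mult'' nonneg mult.commute)
  show m: "mixture_density \<nu> \<pi> F \<in> borel_measurable \<zeta>"
    by (subst measurable_cong[OF eq]) measurable
  show "prob_space (mixture \<zeta> \<nu> \<pi> F)"
  proof
    have "emeasure (mixture \<zeta> \<nu> \<pi> F) (space (mixture \<zeta> \<nu> \<pi> F))
        = (\<integral>\<^sup>+x. mixture_density \<nu> \<pi> F x \<partial>\<zeta>)"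
      using m by (simp add: mixture_def emeasure_density cong: nn_integral_cong)
    also have "\<dots> = (\<integral>\<^sup>+x. (\<integral>\<^sup>+t. ennreal (\<pi> t x) \<partial>D) \<partial>\<zeta>)"
      by (rule nn_integral_cong) (rule eq)
    also have "\<dots> = (\<integral>\<^sup>+t. (\<integral>\<^sup>+x. ennreal (\<pi> t x) \<partial>\<zeta>) \<partial>D)"
      by (rule DZ.Fubini') measurable
    also have "\<dots> = (\<integral>\<^sup>+t. 1 \<partial>D)"
      by (rule nn_integral_cong) (simp add: one D_def)
    finally show "emeasure (mixture \<zeta> \<nu> \<pi> F) (space (mixture \<zeta> \<nu> \<pi> F)) = 1"
      by (simp add: D.emeasure_space_1)
  qed
qed

section \<open>Effect of the weight \<open>h\<close> on mixture densities and on risks\<close>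

text \<open>After multiplication by \<open>h x\<close> the kernel at \<open>x\<close> is
  square-integrable in \<open>t\<close>, so the weighted mixture density is a scalar product with
  that kernel, and orthogonality annihilates the part \<open>c * G\<close>. The scalar
  \<open>c\<close> serves to treat both signs of the perturbation at once.\<close>

lemma weighted_mixture_density_eq:
  assumes meas: "(\<lambda>t. \<pi> t x) \<in> borel_measurable \<nu>"
    and nonneg: "\<And>t. t \<in> space \<nu> \<Longrightarrow> 0 \<le> \<pi> t x" and h: "0 \<le> h x"
    and F: "F \<in> L2_nonneg \<nu>" and K: "K \<in> L2_nonneg \<nu>" and G: "G \<in> L2 \<nu>"
    and orth: "L2_class \<nu> (\<lambda>t. h x * \<pi> t x) \<in> L2_orth \<nu> V" "G \<in> V"
    and K_eq: "AE t in \<nu>. L2_rep K t = L2_rep F t + c * L2_rep G t"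
  shows "ennreal (h x) * mixture_density \<nu> \<pi> K x = ennreal (h x) * mixture_density \<nu> \<pi> F x"
proof -
  let ?p = "\<lambda>t. h x * \<pi> t x"
  \<comment> \<open>Elements of the quotient are nonempty, whereas the class of a function that is
    not square-integrable is empty.\<close>
  have "L2_class \<nu> ?p \<noteq> {}"
    using orth(1) in_quotient_imp_non_empty[OF L2_equiv] by (auto simp: L2_orth_def L2_def)
  then have p: "?p \<in> L2_fun \<nu>" by (auto simp: L2_class_def L2_rel_def)
  have FK: "F \<in> L2 \<nu>" "K \<in> L2 \<nu>" using F K by (auto simp: L2_nonneg_def)
  have r: "L2_rep F \<in> L2_fun \<nu>" "L2_rep K \<in> L2_fun \<nu>" "L2_rep G \<in> L2_fun \<nu>"
    using FK G by (auto intro: L2_rep)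
  have zero: "(LINT t|\<nu>. ?p t * L2_rep G t) = 0"
    using orth L2_inner_class[OF p r(3)] G by (simp add: L2_orth_def L2_rep(2))
  \<comment> \<open>Both factors are in L2, so the extended integral is a finite real one and
    linearity, including subtraction, becomes available.\<close>
  have wt: "ennreal (h x) * mixture_density \<nu> \<pi> J x = ennreal (LINT t|\<nu>. ?p t * L2_rep J t)"
    if J: "J \<in> L2_nonneg \<nu>" for J
  proof -
    have rJ: "L2_rep J \<in> L2_fun \<nu>" using J by (auto simp: L2_nonneg_def intro: L2_rep)
    have AEJ: "AE t in \<nu>. 0 \<le> L2_rep J t" using J by (simp add: L2_nonneg_def)
    have [measurable]: "L2_rep J \<in> borel_measurable \<nu>" "(\<lambda>t. \<pi> t x) \<in> borel_measurable \<nu>"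
      using rJ meas by (auto simp: L2_fun_def)
    have "ennreal (h x) * mixture_density \<nu> \<pi> J x
        = (\<integral>\<^sup>+t. ennreal (h x) * ennreal (\<pi> t x * L2_rep J t) \<partial>\<nu>)"
      unfolding mixture_density_def by (rule nn_integral_cmult[symmetric]) measurable
    also have "\<dots> = (\<integral>\<^sup>+t. ennreal (?p t * L2_rep J t) \<partial>\<nu>)"
      by (rule nn_integral_cong) (simp add: h ennreal_mult'[symmetric] mult.assoc)
    also have "\<dots> = ennreal (LINT t|\<nu>. ?p t * L2_rep J t)"
    proof (rule nn_integral_eq_integral[OF L2_fun_mult[OF p rJ]])
      show "AE t in \<nu>. 0 \<le> ?p t * L2_rep J t"
        using AEJ AE_space by eventually_elim (simp add: h nonneg)
    qed
    finally show ?thesis .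
  qed
  have "(LINT t|\<nu>. ?p t * L2_rep K t) = (LINT t|\<nu>. ?p t * L2_rep F t + c * (?p t * L2_rep G t))"
  proof (rule integral_cong_AE)
    show "AE t in \<nu>. ?p t * L2_rep K t = ?p t * L2_rep F t + c * (?p t * L2_rep G t)"
      using K_eq by eventually_elim (simp add: algebra_simps)
  qed (use p r in \<open>auto simp: L2_fun_def\<close>)
  also have "\<dots> = (LINT t|\<nu>. ?p t * L2_rep F t)"
    using L2_fun_mult[OF p r(1)] L2_fun_mult[OF p r(3)] zero by simp
  finally show ?thesis using wt[OF F] wt[OF K] by simp
qed

text \<open>The product of the weights \<open>h (x i)\<close> is at most \<open>1\<close>, so
  inserting it into the risk integral can only decrease it. The weighted sampling measure is the
  product of copies of \<open>density \<zeta> u\<close>, and \<open>u\<close> can be the same for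
  different \<open>F\<close>; this makes their risks comparable.\<close>

lemma weighted_risk_le:
  assumes m: "mixture_density \<nu> \<pi> F \<in> borel_measurable \<zeta>"
    and prob: "prob_space (mixture \<zeta> \<nu> \<pi> F)"
    and h: "h \<in> borel_measurable \<zeta>" "\<And>x. x \<in> space \<zeta> \<Longrightarrow> 0 \<le> h x \<and> h x \<le> 1"
    and u: "u \<in> borel_measurable \<zeta>" "AE x in \<zeta>. ennreal (h x) * mixture_density \<nu> \<pi> F x = u x"
    and F: "F \<in> L2 \<nu>" and fhat: "fhat \<in> estimators \<zeta> \<nu> n"
  shows "(\<integral>\<^sup>+x. ennreal ((L2_norm \<nu> (L2_minus \<nu> (fhat x) F))\<^sup>2) \<partial>PiM {..<n} (\<lambda>_. density \<zeta> u))
    \<le> risk \<zeta> \<nu> \<pi> n fhat F"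
proof -
  let ?M = "mixture \<zeta> \<nu> \<pi> F"
  let ?L = "\<lambda>x. ennreal ((L2_norm \<nu> (L2_minus \<nu> (fhat x) F))\<^sup>2)"
  let ?w = "\<lambda>x. \<Prod>i<n. ennreal (h (x i))"
  interpret M: prob_space ?M by (rule prob)
  interpret PM: product_sigma_finite "\<lambda>_::nat. ?M" ..
  have setsM[measurable_cong]: "sets ?M = sets \<zeta>" by (simp add: mixture_def)
  then have spM: "space ?M = space \<zeta>" by (rule sets_eq_imp_space_eq)
  have hM[measurable]: "(\<lambda>x. ennreal (h x)) \<in> borel_measurable ?M"
    using h(1) by measurable
  have "fhat \<in> measurable (PiM {..<n} (\<lambda>_. ?M)) (L2_borel \<nu>)"
    using fhat unfolding estimators_def
    by (simp add: measurable_cong_sets[OF sets_PiM_cong[OF refl setsM] refl])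
  from measurable_compose[OF this L2_dist_measurable[OF F]]
  have Lm[measurable]: "?L \<in> borel_measurable (PiM {..<n} (\<lambda>_. ?M))"
    unfolding L2_dist_def by measurable
  have wm[measurable]: "?w \<in> borel_measurable (PiM {..<n} (\<lambda>_. ?M))"
    by measurable
  \<comment> \<open>Densities multiply, and \<open>h\<close> times the mixture density is
    \<open>u\<close> almost everywhere.\<close>
  have du: "density ?M (\<lambda>x. ennreal (h x)) = density \<zeta> u"
    unfolding mixture_def using m h(1) u
    by (subst density_density_eq) (auto intro!: density_cong simp: mult.commute)
  \<comment> \<open>The weight is \<open>ennreal\<close> of a real, hence never infinite, which
    preserves sigma-finiteness.\<close>
  have sf: "sigma_finite_measure (density ?M (\<lambda>x. ennreal (h x)))"
    by (subst M.sigma_finite_iff_density_finite) auto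
  have "PiM {..<n} (\<lambda>_. density \<zeta> u) = density (PiM {..<n} (\<lambda>_. ?M)) ?w"
    using PM.PiM_density_finite[of "{..<n}" "\<lambda>_ x. ennreal (h x)"] hM sf du by simp
  then have "(\<integral>\<^sup>+x. ?L x \<partial>PiM {..<n} (\<lambda>_. density \<zeta> u)) = (\<integral>\<^sup>+x. ?w x * ?L x \<partial>PiM {..<n} (\<lambda>_. ?M))"
    by (simp only: nn_integral_density[OF wm Lm])
  also have "\<dots> \<le> (\<integral>\<^sup>+x. 1 * ?L x \<partial>PiM {..<n} (\<lambda>_. ?M))"
  proof (intro nn_integral_mono mult_right_mono)
    fix x assume "x \<in> space (PiM {..<n} (\<lambda>_. ?M))"
    then show "?w x \<le> 1"
      using h(2) by (intro prod_le_1) (auto simp: space_PiM PiE_iff spM)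
  qed simp
  finally show ?thesis by (simp add: risk_def)
qed

section \<open>Minimax lower bound from the pairs \<open>f\<^sub>0 \<plusminus> f\<close>\<close>

theorem proposition2:
  fixes \<Theta> :: "(real ^ 'd) set"
    and \<nu> :: "(real ^ 'd) measure"
    and \<zeta> :: "'x measure"
    and \<pi> :: "real ^ 'd \<Rightarrow> 'x \<Rightarrow> real"
    and h :: "'x \<Rightarrow> real"
    and f\<^sub>0 :: "(real ^ 'd \<Rightarrow> real) set"
    and C :: "(real ^ 'd \<Rightarrow> real) set set"
    and n :: nat
  assumes "\<Theta> \<in> sets borel"
    and "radon_on \<Theta> \<nu>"
    and "sigma_finite_measure \<zeta>"
    and "(\<lambda>(\<theta>, x). \<pi> \<theta> x) \<in> borel_measurable (restrict_space borel \<Theta> \<Otimes>\<^sub>M \<zeta>)"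
    and "\<And>\<theta> x. \<theta> \<in> \<Theta> \<Longrightarrow> x \<in> space \<zeta> \<Longrightarrow> 0 \<le> \<pi> \<theta> x"
    and "\<And>\<theta>. \<theta> \<in> \<Theta> \<Longrightarrow> (\<integral>\<^sup>+x. ennreal (\<pi> \<theta> x) \<partial>\<zeta>) = 1"
    and "f\<^sub>0 \<in> L2_prob \<nu>"
    and "h \<in> borel_measurable \<zeta>"
    and "\<And>x. x \<in> space \<zeta> \<Longrightarrow> 0 \<le> h x \<and> h x \<le> 1"
    and "C \<subseteq> L2 \<nu>"
    and "C = L2_uminus \<nu> ` C"
    and "AE x in \<zeta>. L2_class \<nu> (\<lambda>\<theta>. h x * \<pi> \<theta> x) \<in> L2_orth \<nu> C"
    and "n \<ge> 1"
  shows "(INF fhat \<in> estimators \<zeta> \<nu> n. SUP f \<in> L2_add \<nu> f\<^sub>0 ` C \<inter> L2_prob \<nu>. risk \<zeta> \<nu> \<pi> n fhat f)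
    \<ge> (SUP f \<in> {f \<in> C. L2_add \<nu> f\<^sub>0 f \<in> L2_prob \<nu> \<and> L2_minus \<nu> f\<^sub>0 f \<in> L2_prob \<nu>}.
          ennreal ((L2_norm \<nu> f)\<^sup>2))
      * (\<integral>\<^sup>+x. ennreal (h x) * mixture_density \<nu> \<pi> f\<^sub>0 x \<partial>\<zeta>) ^ n"
proof -
  note h = assms(8,9)
  have sets_\<nu>[measurable_cong]: "sets \<nu> = sets (restrict_space borel \<Theta>)"
    using assms(2) by (simp add: radon_on_def)
  have space_\<nu>: "space \<nu> = \<Theta>"
    using sets_eq_imp_space_eq[OF sets_\<nu>] by (simp add: space_restrict_space)
  have meas: "(\<lambda>(t, x). \<pi> t x) \<in> borel_measurable (\<nu> \<Otimes>\<^sub>M \<zeta>)"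
    using assms(4) by (simp add: measurable_cong_sets[OF sets_pair_measure_cong[OF sets_\<nu> refl] refl])
  have meas_x: "(\<lambda>t. \<pi> t x) \<in> borel_measurable \<nu>" if "x \<in> space \<zeta>" for x
    using measurable_compose[OF measurable_Pair2'[OF that] meas] by simp
  have prob: "mixture_density \<nu> \<pi> F \<in> borel_measurable \<zeta>" "prob_space (mixture \<zeta> \<nu> \<pi> F)"
    if "F \<in> L2_prob \<nu>" for F
    using mixture_density_prob[OF assms(3) meas _ _ that] assms(5,6) space_\<nu> by auto
  have f0: "f\<^sub>0 \<in> L2_nonneg \<nu>" "f\<^sub>0 \<in> L2 \<nu>"
    using assms(7) by (auto simp: L2_prob_def L2_nonneg_def)
  \<comment> \<open>The density common to the whole argument: orthogonality makes it the weighted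
    mixture density of \<open>f\<^sub>0 + f\<close> and \<open>f\<^sub>0 - f\<close> as
    well.\<close>
  define u where "u = (\<lambda>x. ennreal (h x) * mixture_density \<nu> \<pi> f\<^sub>0 x)"
  have u[measurable]: "u \<in> borel_measurable \<zeta>"
    unfolding u_def using h(1) prob(1)[OF assms(7)] by measurable
  let ?Q = "PiM {..<n} (\<lambda>_. density \<zeta> u)"
  \<comment> \<open>Finite total mass makes \<open>density \<zeta> u\<close> sigma-finite, as
    required to compute the mass of its product.\<close>
  have mass_le: "(\<integral>\<^sup>+x. u x \<partial>\<zeta>) \<le> 1"
  proof -
    interpret prob_space "mixture \<zeta> \<nu> \<pi> f\<^sub>0" by (rule prob(2)[OF assms(7)])
    have "(\<integral>\<^sup>+x. u x \<partial>\<zeta>) \<le> (\<integral>\<^sup>+x. 1 * mixture_density \<nu> \<pi> f\<^sub>0 x \<partial>\<zeta>)"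
      unfolding u_def using h(2) by (intro nn_integral_mono mult_right_mono) auto
    also have "\<dots> = emeasure (mixture \<zeta> \<nu> \<pi> f\<^sub>0) (space (mixture \<zeta> \<nu> \<pi> f\<^sub>0))"
      using prob(1)[OF assms(7)]
      by (simp add: mixture_def emeasure_density cong: nn_integral_cong)
    finally show ?thesis by (simp add: emeasure_space_1)
  qed
  have mass: "emeasure ?Q (space ?Q) = (\<integral>\<^sup>+x. u x \<partial>\<zeta>) ^ n"
  proof -
    have tot: "emeasure (density \<zeta> u) (space \<zeta>) = (\<integral>\<^sup>+x. u x \<partial>\<zeta>)"
      by (simp add: emeasure_density cong: nn_integral_cong)
    then interpret finite_measure "density \<zeta> u"
      using mass_le by (intro finite_measureI) (auto simp: top_unique)
    interpret product_sigma_finite "\<lambda>_::nat. density \<zeta> u" ..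
    show ?thesis
      using emeasure_PiM[of "{..<n}" "\<lambda>_. space \<zeta>"] tot by (simp add: space_PiM)
  qed
  \<comment> \<open>For a fixed estimator and a fixed \<open>f\<close>, both risks are below the
    supremum \<open>?S\<close>; adding them gives twice the bound on the left and
    \<open>2 * ?S\<close> on the right.\<close>
  have key: "ennreal ((L2_norm \<nu> f)\<^sup>2) * (\<integral>\<^sup>+x. u x \<partial>\<zeta>) ^ n
      \<le> (SUP f \<in> L2_add \<nu> f\<^sub>0 ` C \<inter> L2_prob \<nu>. risk \<zeta> \<nu> \<pi> n fhat f)"
    (is "_ \<le> ?S")
    if fhat: "fhat \<in> estimators \<zeta> \<nu> n" and f: "f \<in> C"
      and P: "L2_add \<nu> f\<^sub>0 f \<in> L2_prob \<nu>" and M: "L2_minus \<nu> f\<^sub>0 f \<in> L2_prob \<nu>" for fhat f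
  proof -
    let ?L = "\<lambda>F x. ennreal ((L2_norm \<nu> (L2_minus \<nu> (fhat x) F))\<^sup>2)"
    have fL2: "f \<in> L2 \<nu>" using f assms(10) by auto
    \<comment> \<open>Used with \<open>c = 1\<close> for the sum and \<open>c = -1\<close> for the
      difference.\<close>
    have low: "(\<integral>\<^sup>+x. ?L F x \<partial>?Q) \<le> risk \<zeta> \<nu> \<pi> n fhat F"
      if F: "F \<in> L2_prob \<nu>" and F_eq: "AE t in \<nu>. L2_rep F t = L2_rep f\<^sub>0 t + c * L2_rep f t" for F c
    proof (rule weighted_risk_le[OF prob[OF F] h u _ _ fhat])
      have Fn: "F \<in> L2_nonneg \<nu>" using F by (simp add: L2_prob_def)
      then show "F \<in> L2 \<nu>" by (simp add: L2_nonneg_def)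
      show "AE x in \<zeta>. ennreal (h x) * mixture_density \<nu> \<pi> F x = u x"
        using assms(12) AE_space
      proof eventually_elim
        case (elim x)
        show ?case
          unfolding u_def using elim h(2) assms(5) space_\<nu>
          by (intro weighted_mixture_density_eq[OF meas_x _ _ f0(1) Fn fL2 _ f F_eq]) auto
      qed
    qed
    have "L2_add \<nu> f\<^sub>0 f \<in> L2_add \<nu> f\<^sub>0 ` C \<inter> L2_prob \<nu>" using f P by auto
    then have "risk \<zeta> \<nu> \<pi> n fhat (L2_add \<nu> f\<^sub>0 f) \<le> ?S" by (rule SUP_upper)
    with low[OF P, of 1] L2_rep_add[OF f0(2) fL2]
    have le_P: "(\<integral>\<^sup>+x. ?L (L2_add \<nu> f\<^sub>0 f) x \<partial>?Q) \<le> ?S" by simp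
    \<comment> \<open>Symmetry of \<open>C\<close> enters here: it brings the difference into the
      range of the supremum.\<close>
    have "L2_uminus \<nu> f \<in> C" using f assms(11) by blast
    then have "L2_minus \<nu> f\<^sub>0 f \<in> L2_add \<nu> f\<^sub>0 ` C \<inter> L2_prob \<nu>"
      using M L2_minus_eq_add_uminus[OF f0(2) fL2] by auto
    then have "risk \<zeta> \<nu> \<pi> n fhat (L2_minus \<nu> f\<^sub>0 f) \<le> ?S" by (rule SUP_upper)
    with low[OF M, of "-1"] L2_rep_minus[OF f0(2) fL2]
    have le_M: "(\<integral>\<^sup>+x. ?L (L2_minus \<nu> f\<^sub>0 f) x \<partial>?Q) \<le> ?S" by simp
    have PM: "L2_add \<nu> f\<^sub>0 f \<in> L2 \<nu>" "L2_minus \<nu> f\<^sub>0 f \<in> L2 \<nu>"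
      using P M by (auto simp: L2_prob_def L2_nonneg_def)
    have fhQ: "fhat \<in> measurable ?Q (L2_borel \<nu>)"
      using fhat unfolding estimators_def
      by (simp add: measurable_cong_sets[OF sets_PiM_cong[OF refl sets_density] refl])
    have Lm: "?L F \<in> borel_measurable ?Q" if "F \<in> L2 \<nu>" for F
      using measurable_compose[OF fhQ L2_dist_measurable[OF that]]
      unfolding L2_dist_def by measurable
    \<comment> \<open>The constant is integrated against \<open>?Q\<close>, whose total mass is the
      \<open>n\<close>-th power by \<open>mass\<close>.\<close>
    have "2 * (ennreal ((L2_norm \<nu> f)\<^sup>2) * (\<integral>\<^sup>+x. u x \<partial>\<zeta>) ^ n)
        = (\<integral>\<^sup>+x. 2 * ennreal ((L2_norm \<nu> f)\<^sup>2) \<partial>?Q)"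
      by (simp add: mass mult.assoc)
    also have "\<dots> \<le> (\<integral>\<^sup>+x. ?L (L2_add \<nu> f\<^sub>0 f) x + ?L (L2_minus \<nu> f\<^sub>0 f) x \<partial>?Q)"
    proof (rule nn_integral_mono)
      fix x assume "x \<in> space ?Q"
      then have "fhat x \<in> L2 \<nu>"
        using measurable_space[OF fhQ] by (simp add: L2_borel_def space_measure_of_conv)
      from L2_two_point[OF this f0(2) fL2 PM]
      show "2 * ennreal ((L2_norm \<nu> f)\<^sup>2) \<le> ?L (L2_add \<nu> f\<^sub>0 f) x + ?L (L2_minus \<nu> f\<^sub>0 f) x"
        by (simp add: ennreal_leI flip: ennreal_plus ennreal_mult'' ennreal_numeral)
    qed
    also have "\<dots> = (\<integral>\<^sup>+x. ?L (L2_add \<nu> f\<^sub>0 f) x \<partial>?Q) + (\<integral>\<^sup>+x. ?L (L2_minus \<nu> f\<^sub>0 f) x \<partial>?Q)"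
      by (rule nn_integral_add) (use Lm PM in auto)
    also have "\<dots> \<le> ?S + ?S" by (rule add_mono[OF le_P le_M])
    also have "\<dots> = 2 * ?S" by (simp add: mult_2)
    \<comment> \<open>The factor \<open>2\<close> is finite and nonzero, so it cancels in the
      extended reals.\<close>
    finally show ?thesis
      by (simp add: ennreal_mult_le_mult_iff)
  qed
  show ?thesis
  proof (rule INF_greatest)
    fix fhat assume "fhat \<in> estimators \<zeta> \<nu> n"
    \<comment> \<open>In the extended nonnegative reals a constant factor moves inside any supremum,
      even an empty one, whose value is \<open>0\<close>; then \<open>key\<close> bounds each
      term.\<close>
    then show "(SUP f \<in> {f \<in> C. L2_add \<nu> f\<^sub>0 f \<in> L2_prob \<nu> \<and> L2_minus \<nu> f\<^sub>0 f \<in> L2_prob \<nu>}.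
          ennreal ((L2_norm \<nu> f)\<^sup>2)) * (\<integral>\<^sup>+x. ennreal (h x) * mixture_density \<nu> \<pi> f\<^sub>0 x \<partial>\<zeta>) ^ n
      \<le> (SUP f \<in> L2_add \<nu> f\<^sub>0 ` C \<inter> L2_prob \<nu>. risk \<zeta> \<nu> \<pi> n fhat f)"
      unfolding SUP_mult_right_ennreal using key by (auto intro!: SUP_least simp: u_def)
  qed
qed

end
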